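(* Let $f : \mathbb{R}^d \to \mathbb{R}^p$ be a function. Then $f$ is gauge-integrable if and only if $f$ is gauge-measurable and there exists a gauge-integrable function $h : \mathbb{R}^d \to \mathbb{R}$ such that $|f| \leq h$ in $\mathbb{R}^d$ (i.e. $|f(x)| \le h(x)$ for every $x \in \mathbb{R}^d$).
   Context: A gauge $\gamma$ on $\mathbb{R}^d$ is a function mapping each point $x \in \mathbb{R}^d$ to an open set $\gamma(x) \subset \mathbb{R}^d$ such that $x \in \gamma(x)$. A rectangle in $\mathbb{R}^d$ is a set of the form $R = [a_1,b_1) \times \cdots \times [a_d,b_d)$ with real numbers $a_1<b_1, \ldots, a_d<b_d$; its volume is $\operatorname{vol}(R) = (b_1-a_1)\cdots(b_d-a_d)$. A finite family of rectangles is disjoint if the rectangles are pairwise disjoint; it covers $K$ if $\bigcup_{i=1}^k R_i \supset K$. Gauge integrability: a function $f : \mathbb{R}^d \to \mathbb{R}^p$ is gauge-integrable whenever there exists $I \in \mathbb{R}^p$ such that for every $\epsilon>0$ there exist a gauge $\gamma$ on $\mathbb{R}^d$ and a compact set $K \subset \mathbb{R}^d$ such that, for every finite family of disjoint rectangles $(R_i)_{i\in\{1,\ldots,k\}}$ in $\mathbb{R}^d$ that covers $K$ and every finite family of points $(c_i)_{i\in\{1,\ldots,k\}}$ in $\mathbb{R}^d$ satisfying $R_i \subset \gamma(c_i)$ for every $i \in \{1,\ldots,k\}$, one has $\left| \sum_{i=1}^k f(c_i) \operatorname{vol}(R_i) - I \right| \leq \epsilon$. (The points $c_i$ are not required to belong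 to $R_i$.) Gauge measurability: a function $f : \mathbb{R}^d \to \mathbb{R}^p$ is gauge-measurable whenever, for every $\epsilon>0$ and every $\eta>0$, there exists a gauge $\gamma$ on $\mathbb{R}^d$ such that, for every finite family of disjoint rectangles $(R_i)_{i\in\{1,\ldots,k\}}$ in $\mathbb{R}^d$ and finite families of points $(c_i)_{i\in\{1,\ldots,k\}}$ and $(c'_i)_{i\in\{1,\ldots,k\}}$ in $\mathbb{R}^d$ satisfying $|f(c_i)-f(c'_i)| \geq \eta$ and $R_i \subset \gamma(c_i)\cap\gamma(c'_i)$ for every $i\in\{1,\ldots,k\}$, one has $\sum_{i=1}^k \operatorname{vol}(R_i) \leq \epsilon$. *)

theory Defs
  imports "HOL-Analysis.Analysis"
begin

definition rectangle :: "real^'d \<Rightarrow> real^'d \<Rightarrow> (real^'d) set" where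
  "rectangle a b = {x. \<forall>j. a $ j \<le> x $ j \<and> x $ j < b $ j}"

definition vol :: "real^'d \<Rightarrow> real^'d \<Rightarrow> real" where
  "vol a b = (\<Prod>j\<in>UNIV. b $ j - a $ j)"

text \<open>A family of rectangles is given by the families of its lower and upper corners; the
  following lemma shows that the corners are determined by the rectangles, so nothing is
  lost in doing so.\<close>

lemma rectangle_inject:
  fixes a b a' b' :: "real^'d"
  assumes lt: "\<And>j. a $ j < b $ j" and lt': "\<And>j. a' $ j < b' $ j"
    and eq: "rectangle a b = rectangle a' b'"
  shows "a = a' \<and> b = b'"
proof -
  have "a \<in> rectangle a' b'" "a' \<in> rectangle a b"
    using eq lt lt' by (auto simp: rectangle_def set_eq_iff)
  then have a: "a = a'"
    by (auto simp: rectangle_def vec_eq_iff intro: order.antisym)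
  have upper: "v $ j \<le> u $ j"
    if "\<And>j. a $ j < u $ j" "\<And>j. a $ j < v $ j" "rectangle a u = rectangle a v"
    for u v :: "real^'d" and j
  proof (rule ccontr)
    assume n: "\<not> v $ j \<le> u $ j"
    let ?x = "\<chi> i. if i = j then u $ j else a $ i"
    have "?x \<in> rectangle a v"
      using that(1,2) n by (auto simp: rectangle_def less_imp_le)
    moreover have "?x \<notin> rectangle a u"
      by (auto simp: rectangle_def intro!: exI[of _ j])
    ultimately show False using that(3) by simp
  qed
  have "b = b'"
    using upper[of b b'] upper[of b' b] lt lt' eq a
    by (auto simp: vec_eq_iff intro: order.antisym)
  with a show ?thesis by simp
qed

definition disjoint_rectangles :: "nat \<Rightarrow> (nat \<Rightarrow> real^'d) \<Rightarrow> (nat \<Rightarrow> real^'d) \<Rightarrow> bool" where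
  "disjoint_rectangles k a b \<longleftrightarrow>
     (\<forall>i<k. \<forall>j. a i $ j < b i $ j) \<and>
     disjoint_family_on (\<lambda>i. rectangle (a i) (b i)) {..<k}"

text \<open>The sample points \<open>c i\<close> need not lie in the corresponding rectangles, as they must for the
  tagged divisions underlying the Henstock--Kurzweil integral of the library.\<close>

definition gauge_integrable :: "(real^'d \<Rightarrow> 'b::real_normed_vector) \<Rightarrow> bool" where
  "gauge_integrable f \<longleftrightarrow>
     (\<exists>I. \<forall>\<epsilon>>0. \<exists>\<gamma> K. gauge \<gamma> \<and> compact K \<and>
        (\<forall>k a b c.
           disjoint_rectangles k a b \<longrightarrow>
           K \<subseteq> (\<Union>i<k. rectangle (a i) (b i)) \<longrightarrow>
           (\<forall>i<k. rectangle (a i) (b i) \<subseteq> \<gamma> (c i)) \<longrightarrow>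
           norm ((\<Sum>i<k. vol (a i) (b i) *\<^sub>R f (c i)) - I) \<le> \<epsilon>))"

definition gauge_measurable :: "(real^'d \<Rightarrow> 'b::real_normed_vector) \<Rightarrow> bool" where
  "gauge_measurable f \<longleftrightarrow>
     (\<forall>\<epsilon>>0. \<forall>\<eta>>0. \<exists>\<gamma>. gauge \<gamma> \<and>
        (\<forall>k a b c c'.
           disjoint_rectangles k a b \<longrightarrow>
           (\<forall>i<k. norm (f (c i) - f (c' i)) \<ge> \<eta> \<and>
                  rectangle (a i) (b i) \<subseteq> \<gamma> (c i) \<inter> \<gamma> (c' i)) \<longrightarrow>
           (\<Sum>i<k. vol (a i) (b i)) \<le> \<epsilon>))"

end

theory Submission
  imports Defs
begin

text \<open>Because the sample points need not lie in their rectangles, a fine family may be re-tagged at will.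
  Comparing two taggings of one family, on each of its subfamilies, shows that gauge integrability is
  equivalent to an absolute Cauchy condition: \<open>\<Sum> vol R\<^sub>i |f c\<^sub>i - f c'\<^sub>i|\<close> is small for
  all doubly tagged fine families, and \<open>\<Sum> vol R\<^sub>i |f c\<^sub>i|\<close> is small for all fine families
  outside a compact set. This condition passes from \<open>f\<close> to \<open>|f|\<close>, and it implies
  measurability by Chebyshev's inequality. Conversely, when \<open>f\<close> is measurable and dominated by
  \<open>h\<close>, the rectangles outside a compact set are controlled by \<open>h\<close>, those inside with
  \<open>|f c\<^sub>i - f c'\<^sub>i| < \<eta>\<close> by \<open>\<eta>\<close> times a fixed volume, and the others by absolute
  continuity of the integral of \<open>h\<close>, since their total volume is small.\<close>

section \<open>Families of half-open rectangles\<close>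

abbreviation leb :: "(real^'d) set \<Rightarrow> real" where
  "leb \<equiv> measure lborel"

definition is_rectangle :: "(real^'d) set \<Rightarrow> bool" where
  "is_rectangle S \<longleftrightarrow> (\<exists>a b. (\<forall>j. a $ j < b $ j) \<and> S = rectangle a b)"

lemma rectangle_subset_cbox: "rectangle a b \<subseteq> cbox a b"
  by (auto simp: rectangle_def mem_box_cart less_imp_le)

lemma box_subset_rectangle: "box a b \<subseteq> rectangle a b"
  by (auto simp: rectangle_def mem_box_cart less_imp_le)

lemma rectangle_nonempty_iff: "rectangle a b \<noteq> {} \<longleftrightarrow> (\<forall>j. a $ j < b $ j)"
proof
  show "\<forall>j. a $ j < b $ j" if "rectangle a b \<noteq> {}"
    using that unfolding rectangle_def by (auto intro: le_less_trans)
next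
  assume "\<forall>j. a $ j < b $ j"
  then have "a \<in> rectangle a b"
    by (auto simp: rectangle_def)
  then show "rectangle a b \<noteq> {}"
    by blast
qed

lemma is_rectangle_iff: "is_rectangle S \<longleftrightarrow> S \<noteq> {} \<and> (\<exists>a b. S = rectangle a b)"
  unfolding is_rectangle_def using rectangle_nonempty_iff by blast

lemma rectangle_Int:
  "rectangle a b \<inter> rectangle a' b' = rectangle (\<chi> j. max (a $ j) (a' $ j)) (\<chi> j. min (b $ j) (b' $ j))"
  by (auto simp: rectangle_def)

lemma is_rectangle_Int:
  "is_rectangle S \<Longrightarrow> is_rectangle T \<Longrightarrow> S \<inter> T \<noteq> {} \<Longrightarrow> is_rectangle (S \<inter> T)"
  unfolding is_rectangle_iff by (metis rectangle_Int)

lemma rectangle_borel: "rectangle a b \<in> sets borel"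
proof -
  have "rectangle a b = (\<Inter>j. {x. a $ j \<le> x $ j} \<inter> {x. x $ j < b $ j})"
    by (auto simp: rectangle_def)
  also have "\<dots> \<in> sets borel"
    by (intro sets.finite_INT sets.Int borel_closed borel_open)
       (auto intro!: closed_Collect_le open_Collect_less continuous_intros)
  finally show ?thesis .
qed

lemma is_rectangle_borel: "is_rectangle S \<Longrightarrow> S \<in> sets borel"
  unfolding is_rectangle_def by (auto simp: rectangle_borel)

lemma is_rectangle_lmeasurable: "is_rectangle S \<Longrightarrow> S \<in> fmeasurable lborel"
  unfolding is_rectangle_def
  by (auto intro!: fmeasurableI2[OF fmeasurable_cbox rectangle_subset_cbox] simp: rectangle_borel)

text \<open>The half-open rectangle lies between the open and the closed box with the same corners,
  and these two have equal measure.\<close>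

lemma leb_rectangle:
  assumes "\<And>j. a $ j < b $ j"
  shows "leb (rectangle a b) = vol a b"
proof (rule antisym)
  have ne: "cbox a b \<noteq> {}"
    using assms by (simp add: interval_ne_empty_cart less_imp_le)
  have c: "measure lborel (cbox a b) = vol a b"
    using content_cbox_cart[OF ne] by (simp add: vol_def)
  show "leb (rectangle a b) \<le> vol a b"
    unfolding c[symmetric]
    by (intro measure_mono_fmeasurable rectangle_subset_cbox) (auto simp: rectangle_borel)
  have "vol a b = measure lborel (box a b)"
    using c by (simp add: measure_lborel_box_eq measure_lborel_cbox_eq)
  also have "\<dots> \<le> leb (rectangle a b)"
    using assms
    by (intro measure_mono_fmeasurable box_subset_rectangle is_rectangle_lmeasurable)
       (auto simp: is_rectangle_def)
  finally show "vol a b \<le> leb (rectangle a b)" .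
qed

text \<open>The index set is arbitrary, not an initial segment of the naturals, so that subfamilies,
  disjoint sums, families indexed by pairs and sets of rectangles indexed by themselves need no
  renumbering.\<close>

definition rectangle_family :: "'i set \<Rightarrow> ('i \<Rightarrow> (real^'d) set) \<Rightarrow> bool" where
  "rectangle_family J R \<longleftrightarrow>
     finite J \<and> (\<forall>i\<in>J. is_rectangle (R i)) \<and> disjoint_family_on R J"

lemma rectangle_family_subset:
  "rectangle_family J R \<Longrightarrow> J' \<subseteq> J \<Longrightarrow> rectangle_family J' R"
  unfolding rectangle_family_def using finite_subset disjoint_family_on_mono by blast

lemma disjoint_rectangles_family:
  "disjoint_rectangles k a b \<Longrightarrow> rectangle_family {..<k} (\<lambda>i. rectangle (a i) (b i))"
  unfolding disjoint_rectangles_def rectangle_family_def is_rectangle_def by blast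

text \<open>The bridge back to the numbered families of corners in the original definitions: a
  finite index set is listed by a bijection, and corners are chosen for each member.\<close>

lemma rectangle_family_enumerate:
  assumes "rectangle_family J R"
  obtains k e a b where "bij_betw e {..<k} J" "disjoint_rectangles k a b"
    "\<And>i. i < k \<Longrightarrow> R (e i) = rectangle (a i) (b i)"
    "\<And>i. i < k \<Longrightarrow> vol (a i) (b i) = leb (R (e i))"
proof -
  have fin: "finite J" and rect: "\<And>i. i \<in> J \<Longrightarrow> is_rectangle (R i)"
    and disj: "disjoint_family_on R J"
    using assms by (auto simp: rectangle_family_def)
  obtain e where e: "bij_betw e {..<card J} J"
    using ex_bij_betw_nat_finite[OF fin] by (auto simp: lessThan_atLeast0)
  then have eJ: "e i \<in> J" if "i < card J" for i
    using that by (auto simp: bij_betw_def)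
  have "\<exists>a b. (\<forall>j. a $ j < b $ j) \<and> R i = rectangle a b" if "i \<in> J" for i
    using rect[OF that] by (auto simp: is_rectangle_def)
  then obtain a b where ab: "\<And>i j. i \<in> J \<Longrightarrow> a i $ j < b i $ j"
      "\<And>i. i \<in> J \<Longrightarrow> R i = rectangle (a i) (b i)"
    by metis
  show thesis
  proof (rule that[OF e, of "a \<circ> e" "b \<circ> e"])
    have "rectangle (a (e i)) (b (e i)) \<inter> rectangle (a (e j)) (b (e j)) = {}"
      if "i < card J" "j < card J" "i \<noteq> j" for i j
    proof -
      have "e i \<noteq> e j"
        using e that by (auto simp: bij_betw_def inj_on_def)
      then show ?thesis
        using disj ab(2) eJ that by (metis disjoint_family_onD)
    qed
    then show "disjoint_rectangles (card J) (a \<circ> e) (b \<circ> e)"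
      using ab(1) eJ by (auto simp: disjoint_rectangles_def disjoint_family_on_def)
    fix i assume "i < card J"
    then show "vol ((a \<circ> e) i) ((b \<circ> e) i) = leb (R (e i))"
      using leb_rectangle[OF ab(1)[OF eJ]] ab(2)[OF eJ] by simp
  qed (use eJ ab(2) in simp)
qed

lemma rectangle_family_lmeasurable:
  "rectangle_family J R \<Longrightarrow> i \<in> J \<Longrightarrow> R i \<in> fmeasurable lborel"
  by (simp add: rectangle_family_def is_rectangle_lmeasurable)

lemma rectangle_family_sum_leb_le:
  assumes R: "rectangle_family J R" and B: "compact B" "\<And>i. i \<in> J \<Longrightarrow> R i \<subseteq> B"
  shows "(\<Sum>i\<in>J. leb (R i)) \<le> leb B"
proof -
  have "(\<Sum>i\<in>J. leb (R i)) = leb (\<Union>i\<in>J. R i)"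
    using R rectangle_family_lmeasurable[OF R]
    by (intro measure_UNION'[symmetric])
       (auto simp: rectangle_family_def disjoint_family_on_def pairwise_def disjnt_def fmeasurable_def)
  also have "\<dots> \<le> leb B"
    using R B rectangle_family_lmeasurable[OF R] fmeasurable_compact[OF B(1)]
    by (intro measure_mono_fmeasurable sets.finite_UN)
       (auto simp: rectangle_family_def fmeasurable_def)
  finally show ?thesis .
qed

text \<open>Additivity of the measure. It cuts each rectangle of one family along another family,
  leaving the remainder that the other family misses.\<close>

lemma rectangle_family_leb_split:
  assumes R': "rectangle_family J' R'" and S: "is_rectangle S"
  shows "leb S = (\<Sum>j\<in>J'. leb (S \<inter> R' j)) + leb (S - (\<Union>j\<in>J'. R' j))"
proof -
  have S': "S \<in> fmeasurable lborel"
    using S by (rule is_rectangle_lmeasurable)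
  have m: "(\<Union>j\<in>J'. R' j) \<in> sets lborel"
    using R' rectangle_family_lmeasurable[OF R'] by (auto simp: rectangle_family_def fmeasurable_def)
  have "leb (S \<inter> (\<Union>j\<in>J'. R' j)) = (\<Sum>j\<in>J'. leb (S \<inter> R' j))"
    unfolding Int_UN_distrib
  proof (rule measure_UNION')
    show "pairwise (\<lambda>i j. disjnt (S \<inter> R' i) (S \<inter> R' j)) J'"
      using R' unfolding rectangle_family_def disjoint_family_on_def pairwise_def disjnt_def by blast
  qed (use R' rectangle_family_lmeasurable[OF R'] S' in
       \<open>auto simp: rectangle_family_def intro!: fmeasurable_Int_fmeasurable dest: fmeasurableD\<close>)
  moreover have "leb S = leb (S \<inter> (\<Union>j\<in>J'. R' j)) + leb (S - (\<Union>j\<in>J'. R' j))"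
  proof -
    have "S - S \<inter> (\<Union>j\<in>J'. R' j) = S - (\<Union>j\<in>J'. R' j)"
      by blast
    moreover have "S \<inter> (\<Union>j\<in>J'. R' j) \<in> sets lborel"
      using fmeasurableD[OF S'] m by (rule sets.Int)
    ultimately show ?thesis
      using measurable_measure_Diff[OF S', of "S \<inter> (\<Union>j\<in>J'. R' j)"] by (metis Int_lower1 add.commute diff_add_cancel)
  qed
  ultimately show ?thesis
    by simp
qed

section \<open>Completing a family to a fine cover\<close>

text \<open>On closed boxes this recovers the half-open rectangle with the same corners; unlike the
  passage through corners it is defined without choices.\<close>

definition half_open :: "(real^'d) set \<Rightarrow> (real^'d) set" where
  "half_open S = {x. \<exists>\<^sub>F t in at_right 0. x + vec t \<in> S}"

text \<open>A small step along the diagonal stays inside the box when every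
  \<open>x $ j < b $ j\<close> and \<open>a $ j \<le> x $ j\<close>. If instead some coordinate is
  below \<open>a $ j\<close>, or at or above \<open>b $ j\<close>, all small steps land
  outside.\<close>

lemma half_open_cbox: "half_open (cbox a b) = rectangle a b"
proof (intro set_eqI iffI)
  fix x assume "x \<in> rectangle a b"
  then have x: "a $ j \<le> x $ j" "x $ j < b $ j" for j
    by (auto simp: rectangle_def)
  have "\<forall>\<^sub>F t in at_right 0. \<forall>j. a $ j \<le> x $ j + t \<and> x $ j + t \<le> b $ j"
  proof (intro eventually_all_finite)
    fix j
    have "\<forall>\<^sub>F t in at_right 0. t \<in> {0<..<b $ j - x $ j}"
      using x(2)[of j] by (intro eventually_at_right_real) simp
    then show "\<forall>\<^sub>F t in at_right 0. a $ j \<le> x $ j + t \<and> x $ j + t \<le> b $ j"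
      using x(1)[of j] by (auto elim!: eventually_mono)
  qed
  then show "x \<in> half_open (cbox a b)"
    by (auto simp: half_open_def mem_box_cart intro!: eventually_frequently trivial_limit_at_right_real)
next
  fix x assume x: "x \<in> half_open (cbox a b)"
  show "x \<in> rectangle a b"
  proof (rule ccontr)
    assume "x \<notin> rectangle a b"
    then obtain j where j: "x $ j < a $ j \<or> b $ j \<le> x $ j"
      by (auto simp: rectangle_def not_le not_less)
    have "\<forall>\<^sub>F t in at_right 0. x $ j + t < a $ j \<or> b $ j < x $ j + t"
    proof (cases "x $ j < a $ j")
      case True
      then have "\<forall>\<^sub>F t in at_right 0. t \<in> {0<..<a $ j - x $ j}"
        by (intro eventually_at_right_real) simp
      then show ?thesis
        by (auto elim!: eventually_mono)
    next
      case False
      \<comment> \<open>Only positivity of \<open>t\<close> matters; the bound 1 is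
        arbitrary.\<close>
      have "\<forall>\<^sub>F t in at_right (0::real). t \<in> {0<..<1}"
        by (intro eventually_at_right_real) simp
      then show ?thesis
        using False j by (auto elim!: eventually_mono)
    qed
    then have "\<forall>\<^sub>F t in at_right 0. x + vec t \<notin> cbox a b"
      by (rule eventually_mono) (auto simp: mem_box_cart not_le intro!: exI[of _ j])
    then show False
      using x by (simp add: half_open_def frequently_def)
  qed
qed

text \<open>The quantifier \<open>\<exists>\<^sub>F\<close> distributes over finite disjunctions: if
  the points \<open>x + vec t\<close> lie in a finite union for arbitrarily small \<open>t\<close>,
  a single member captures them for arbitrarily small \<open>t\<close>. Covers by closed boxes thus
  become covers by half-open ones.\<close>

lemma rectangle_subset_Union_half_open:
  assumes "finite D" "cbox a b \<subseteq> \<Union>D"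
  shows "rectangle a b \<subseteq> (\<Union>S\<in>D. half_open S)"
proof
  fix x assume "x \<in> rectangle a b"
  then have "\<exists>\<^sub>F t in at_right 0. x + vec t \<in> cbox a b"
    unfolding half_open_cbox[symmetric] by (simp add: half_open_def)
  then have "\<exists>\<^sub>F t in at_right 0. \<exists>S\<in>D. x + vec t \<in> S"
    by (rule frequently_elim1) (use assms in auto)
  then show "x \<in> (\<Union>S\<in>D. half_open S)"
    using frequently_bex_finite[OF assms(1)] by (auto simp: half_open_def)
qed

text \<open>Two half-open rectangles that meet do so in a nondegenerate rectangle, whose nonempty
  interior would lie in both open boxes.\<close>

lemma box_disjoint_imp_rectangle_disjoint:
  fixes a b a' b' :: "real^'d"
  assumes "box a b \<inter> box a' b' = {}"
  shows "rectangle a b \<inter> rectangle a' b' = {}"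
proof (rule ccontr)
  let ?l = "\<chi> j. max (a $ j) (a' $ j)" and ?u = "\<chi> j. min (b $ j) (b' $ j)"
  assume "rectangle a b \<inter> rectangle a' b' \<noteq> {}"
  then have "\<forall>j. ?l $ j < ?u $ j"
    unfolding rectangle_Int rectangle_nonempty_iff .
  then have "box ?l ?u \<noteq> {}"
    by (simp add: interval_ne_empty_cart)
  moreover have "box ?l ?u \<subseteq> box a b \<inter> box a' b'"
    by (auto simp: mem_box_cart)
  ultimately show False
    using assms by blast
qed

lemma bounded_subset_rectangle:
  assumes "bounded (S :: (real^'d) set)"
  obtains a b where "S \<subseteq> rectangle a b"
proof -
  obtain a where "S \<subseteq> box (- a) a"
    using bounded_subset_box_symmetric[OF assms] .
  then show thesis
    using that box_subset_rectangle by blast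
qed

definition fine_family ::
    "(real^'d \<Rightarrow> (real^'d) set) \<Rightarrow> 'i set \<Rightarrow> ('i \<Rightarrow> (real^'d) set) \<Rightarrow> ('i \<Rightarrow> real^'d) \<Rightarrow> bool" where
  "fine_family \<gamma> J R c \<longleftrightarrow> rectangle_family J R \<and> (\<forall>i\<in>J. R i \<subseteq> \<gamma> (c i))"

lemma fine_familyD:
  assumes "fine_family \<gamma> J R c"
  shows "rectangle_family J R" "finite J" "\<And>i. i \<in> J \<Longrightarrow> is_rectangle (R i)"
    "\<And>i. i \<in> J \<Longrightarrow> R i \<subseteq> \<gamma> (c i)"
  using assms by (auto simp: fine_family_def rectangle_family_def)

lemma fine_family_mono:
  "fine_family \<gamma> J R c \<Longrightarrow> (\<And>x. \<gamma> x \<subseteq> \<gamma>' x) \<Longrightarrow> fine_family \<gamma>' J R c"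
  unfolding fine_family_def by blast

lemma fine_family_subset:
  "fine_family \<gamma> J R c \<Longrightarrow> J' \<subseteq> J \<Longrightarrow> fine_family \<gamma> J' R c"
  unfolding fine_family_def using rectangle_family_subset by blast

text \<open>Sums are compared with the integral only over covers of a compact set, so a given family
  has to be enlarged to a cover by fine rectangles. The closed boxes form a partial division, which
  extends to a division of a large box; Cousin's lemma subdivides the new cells finely, and
  \<open>half_open\<close> returns to disjoint rectangles. The given family itself may be
  arbitrarily coarse.\<close>

lemma fine_completion:
  fixes R :: "'i \<Rightarrow> (real^'d) set"
  assumes R: "rectangle_family J R" and \<gamma>: "gauge \<gamma>" and K: "bounded K"
  obtains Q t where "fine_family \<gamma> Q (\<lambda>S. S) t"
    "(\<Union>i\<in>J. R i) \<inter> \<Union>Q = {}" "K \<subseteq> (\<Union>i\<in>J. R i) \<union> \<Union>Q"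
proof -
  have fin: "finite J" and disj: "disjoint_family_on R J"
    using R by (auto simp: rectangle_family_def)
  have "\<exists>a b. (\<forall>j. a $ j < b $ j) \<and> R i = rectangle a b" if "i \<in> J" for i
    using R that by (auto simp: rectangle_family_def is_rectangle_def)
  then obtain a b where ab: "\<And>i j. i \<in> J \<Longrightarrow> a i $ j < b i $ j"
      "\<And>i. i \<in> J \<Longrightarrow> R i = rectangle (a i) (b i)"
    by metis
  define D where "D = (\<lambda>i. cbox (a i) (b i)) ` J"
  have Rh: "R i = half_open (cbox (a i) (b i))" if "i \<in> J" for i
    using ab(2)[OF that] by (simp add: half_open_cbox)
  have bd: "bounded (K \<union> \<Union>D)"
    using fin K by (auto simp: D_def)
  obtain A B where AB: "K \<union> \<Union>D \<subseteq> rectangle A B"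
    using bounded_subset_rectangle[OF bd] .
  have div: "D division_of \<Union>D"
  proof (rule division_ofI)
    fix k1 k2 assume "k1 \<in> D" "k2 \<in> D" "k1 \<noteq> k2"
    then obtain i i' where i: "i \<in> J" "k1 = cbox (a i) (b i)" "i' \<in> J" "k2 = cbox (a i') (b i')" "i \<noteq> i'"
      by (auto simp: D_def)
    then have "rectangle (a i) (b i) \<inter> rectangle (a i') (b i') = {}"
      using disj ab(2) by (metis disjoint_family_onD)
    then show "interior k1 \<inter> interior k2 = {}"
      using box_subset_rectangle[of "a i" "b i"] box_subset_rectangle[of "a i'" "b i'"] i
      by (auto simp: interior_cbox)
  next
    fix k assume "k \<in> D"
    then obtain i where "i \<in> J" "k = cbox (a i) (b i)"
      by (auto simp: D_def)
    then show "k \<noteq> {}"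
      using ab(1) by (metis interval_ne_empty_cart(1) less_imp_le)
  qed (use fin in \<open>auto simp: D_def\<close>)
  \<comment> \<open>The old boxes are kept as cells of the division; only the cells in
    \<open>q - D\<close> are subdivided below.\<close>
  obtain q where q: "D \<subseteq> q" "q division_of cbox A B"
  proof (rule partial_division_extend_interval[OF div])
    show "\<Union>D \<subseteq> cbox A B"
      using AB rectangle_subset_cbox[of A B] by auto
  qed
  note qD = division_ofD[OF q(2)]
  obtain p where p: "p tagged_division_of \<Union>(q - D)" "\<gamma> fine p"
  proof (rule tagged_division_Union_exists[of "q - D" \<gamma> "\<Union>(q - D)"])
    show "\<forall>i\<in>q - D. \<exists>p. p tagged_division_of i \<and> \<gamma> fine p"
      using qD(4) fine_division_exists[OF \<gamma>] by (metis Diff_iff)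
  qed (use qD in auto)
  note pD = tagged_division_ofD[OF p(1)]
  \<comment> \<open>Degenerate boxes of the tagged division have an empty half-open version, which
    is not a rectangle and is removed.\<close>
  define Q where "Q = half_open ` snd ` p - {{}}"
  have snd_p: "\<exists>u v. k = cbox u v" if "k \<in> snd ` p" for k
    using that pD(4) by auto
  have Qrect: "is_rectangle S" if "S \<in> Q" for S
    using that snd_p by (force simp: Q_def is_rectangle_iff half_open_cbox)
  have disj': "half_open k1 \<inter> half_open k2 = {}"
    if k: "\<exists>u v. k1 = cbox u v" "\<exists>u v. k2 = cbox u v" "interior k1 \<inter> interior k2 = {}" for k1 k2
    using k box_disjoint_imp_rectangle_disjoint by (force simp: half_open_cbox interior_cbox)
  have Qdisj: "disjoint_family_on (\<lambda>S. S) Q"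
    unfolding disjoint_family_on_def
  proof (intro ballI impI)
    fix S T assume "S \<in> Q" "T \<in> Q" "S \<noteq> T"
    then obtain x k x' k' where k: "(x, k) \<in> p" "(x', k') \<in> p" "S = half_open k" "T = half_open k'"
      unfolding Q_def by force
    with \<open>S \<noteq> T\<close> have "(x, k) \<noteq> (x', k')"
      by auto
    then show "S \<inter> T = {}"
      unfolding k(3,4) using k(1,2) pD(4,5) by (intro disj') blast+
  qed
  have "\<exists>x. S \<subseteq> \<gamma> x" if S: "S \<in> Q" for S
  proof -
    obtain x k where k: "(x, k) \<in> p" "S = half_open k"
      using S unfolding Q_def by force
    moreover obtain u v where "k = cbox u v"
      using pD(4) k by blast
    moreover have "k \<subseteq> \<gamma> x"
      using p(2) k(1) by (auto simp: fine_def)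
    ultimately show ?thesis
      using rectangle_subset_cbox[of u v] half_open_cbox[of u v] by blast
  qed
  then obtain t where t: "\<And>S. S \<in> Q \<Longrightarrow> S \<subseteq> \<gamma> (t S)"
    by metis
  show thesis
  proof (rule that)
    show "fine_family \<gamma> Q (\<lambda>S. S) t"
      using Qrect Qdisj t pD(1) by (auto simp: fine_family_def rectangle_family_def Q_def)
  next
    have "R i \<inter> S = {}" if i: "i \<in> J" and S: "S \<in> Q" for i S
    proof -
      obtain x k where k: "(x, k) \<in> p" "S = half_open k"
        using S unfolding Q_def by force
      have D1: "cbox (a i) (b i) \<in> D"
        using i by (auto simp: D_def)
      \<comment> \<open>An old box has no interior point in common with the union of the new cells,
        hence none with any piece of their subdivision.\<close>
      have "interior (cbox (a i) (b i)) \<inter> interior (\<Union>(q - D)) = {}"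
      proof (rule Int_interior_Union_intervals)
        fix T assume "T \<in> q - D"
        then show "interior (cbox (a i) (b i)) \<inter> interior T = {}"
          using qD(5) q(1) D1 by blast
      qed (use qD in auto)
      moreover have "interior k \<subseteq> interior (\<Union>(q - D))"
        using pD(3)[OF k(1)] by (rule interior_mono)
      ultimately have "interior (cbox (a i) (b i)) \<inter> interior k = {}"
        by blast
      then show ?thesis
        unfolding Rh[OF i] k(2) using pD(4)[OF k(1)] by (intro disj') auto
    qed
    then show "(\<Union>i\<in>J. R i) \<inter> \<Union>Q = {}"
      by blast
  next
    have "\<Union>q = \<Union>D \<union> \<Union>(q - D)"
      using q(1) by blast
    moreover have "\<Union>(q - D) = \<Union>(snd ` p)"
      unfolding pD(6)[symmetric] by force
    ultimately have "cbox A B \<subseteq> \<Union>(D \<union> snd ` p)"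
      using qD(6) by auto
    then have "rectangle A B \<subseteq> (\<Union>S\<in>D \<union> snd ` p. half_open S)"
      using fin pD(1) by (intro rectangle_subset_Union_half_open) (auto simp: D_def)
    also have "\<dots> \<subseteq> (\<Union>i\<in>J. R i) \<union> \<Union>Q"
    proof -
      have "(\<Union>S\<in>snd ` p. half_open S) = \<Union>Q"
        unfolding Q_def by blast
      then show ?thesis
        using Rh by (auto simp: D_def)
    qed
    finally show "K \<subseteq> (\<Union>i\<in>J. R i) \<union> \<Union>Q"
      using AB by blast
  qed
qed

section \<open>Absolute Cauchy condition\<close>

definition riemann_sum ::
    "(real^'d \<Rightarrow> 'b::real_normed_vector) \<Rightarrow> 'i set \<Rightarrow> ('i \<Rightarrow> (real^'d) set) \<Rightarrow> ('i \<Rightarrow> real^'d) \<Rightarrow> 'b" where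
  "riemann_sum f J R c = (\<Sum>i\<in>J. leb (R i) *\<^sub>R f (c i))"

lemma fine_family_reindex:
  assumes "bij_betw e J' J" "fine_family \<gamma> J R c"
  shows "fine_family \<gamma> J' (\<lambda>i. R (e i)) (\<lambda>i. c (e i))"
proof -
  have "R (e i) \<inter> R (e j) = {}" if "i \<in> J'" "j \<in> J'" "i \<noteq> j" for i j
  proof -
    have "e i \<noteq> e j" "e i \<in> J" "e j \<in> J"
      using assms(1) that by (auto simp: bij_betw_def inj_on_def)
    then show ?thesis
      using assms(2) unfolding fine_family_def rectangle_family_def by (metis disjoint_family_onD)
  qed
  moreover have "finite J'"
    using assms bij_betw_finite by (auto simp: fine_family_def rectangle_family_def)
  ultimately show ?thesis
    using assms by (auto simp: fine_family_def rectangle_family_def disjoint_family_on_def bij_betw_def)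
qed

definition sums_close ::
    "(real^'d \<Rightarrow> 'b::real_normed_vector) \<Rightarrow> 'b \<Rightarrow> real \<Rightarrow> (real^'d \<Rightarrow> (real^'d) set) \<Rightarrow> (real^'d) set \<Rightarrow> bool" where
  "sums_close f I \<epsilon> \<gamma> K \<longleftrightarrow> gauge \<gamma> \<and> compact K \<and>
     (\<forall>k a b c. disjoint_rectangles k a b \<longrightarrow> K \<subseteq> (\<Union>i<k. rectangle (a i) (b i)) \<longrightarrow>
        (\<forall>i<k. rectangle (a i) (b i) \<subseteq> \<gamma> (c i)) \<longrightarrow>
        norm ((\<Sum>i<k. vol (a i) (b i) *\<^sub>R f (c i)) - I) \<le> \<epsilon>)"

lemma gauge_integrable_iff: "gauge_integrable f \<longleftrightarrow> (\<exists>I. \<forall>\<epsilon>>0. \<exists>\<gamma> K. sums_close f I \<epsilon> \<gamma> K)"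
  unfolding gauge_integrable_def sums_close_def ..

lemma sums_close_family:
  assumes sums: "sums_close f I \<epsilon> \<gamma> K"
    and fine: "fine_family \<gamma> J R c" and K: "K \<subseteq> (\<Union>i\<in>J. R i)"
  shows "norm (riemann_sum f J R c - I) \<le> \<epsilon>"
proof -
  obtain k e a b where e: "bij_betw e {..<k} J" and ab: "disjoint_rectangles k a b"
      "\<And>i. i < k \<Longrightarrow> R (e i) = rectangle (a i) (b i)"
      "\<And>i. i < k \<Longrightarrow> vol (a i) (b i) = leb (R (e i))"
    using rectangle_family_enumerate[OF fine_familyD(1)[OF fine]] by metis
  have J: "J = e ` {..<k}"
    using e by (simp add: bij_betw_def)
  have "riemann_sum f J R c = (\<Sum>i<k. vol (a i) (b i) *\<^sub>R f (c (e i)))"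
    unfolding riemann_sum_def sum.reindex_bij_betw[OF e, symmetric] using ab(3) by simp
  moreover have "K \<subseteq> (\<Union>i<k. rectangle (a i) (b i))"
    using K ab(2) by (auto simp: J)
  moreover have "\<forall>i<k. rectangle (a i) (b i) \<subseteq> \<gamma> (c (e i))"
    using fine_familyD(4)[OF fine] ab(2) by (auto simp: J)
  ultimately show ?thesis
    using sums ab(1) unfolding sums_close_def by simp
qed

text \<open>The absolute Cauchy condition at a single \<epsilon>. A definition cannot quantify over
  index types, so the families are indexed by sets of naturals; \<open>controls_pairs\<close> and
  \<open>controls_outside\<close> lift both clauses to any index type.\<close>

definition controls ::
    "(real^'d \<Rightarrow> 'b::real_normed_vector) \<Rightarrow> real \<Rightarrow> (real^'d \<Rightarrow> (real^'d) set) \<Rightarrow> (real^'d) set \<Rightarrow> bool" where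
  "controls f \<epsilon> \<gamma> K \<longleftrightarrow> gauge \<gamma> \<and> compact K \<and>
     (\<forall>(J::nat set) R c c'. fine_family \<gamma> J R c \<longrightarrow> fine_family \<gamma> J R c' \<longrightarrow>
        (\<Sum>i\<in>J. leb (R i) * norm (f (c i) - f (c' i))) \<le> \<epsilon>) \<and>
     (\<forall>(J::nat set) R c. fine_family \<gamma> J R c \<longrightarrow> (\<forall>i\<in>J. R i \<inter> K = {}) \<longrightarrow>
        (\<Sum>i\<in>J. leb (R i) * norm (f (c i))) \<le> \<epsilon>)"

definition absolutely_cauchy :: "(real^'d \<Rightarrow> 'b::real_normed_vector) \<Rightarrow> bool" where
  "absolutely_cauchy f \<longleftrightarrow> (\<forall>\<epsilon>>0. \<exists>\<gamma> K. controls f \<epsilon> \<gamma> K)"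

lemma controls_pairs:
  assumes f: "controls f \<epsilon> \<gamma> K" and fine: "fine_family \<gamma> J R c" "fine_family \<gamma> J R c'"
  shows "(\<Sum>i\<in>J. leb (R i) * norm (f (c i) - f (c' i))) \<le> \<epsilon>"
proof -
  obtain e where e: "bij_betw e {..<card J} J"
    using ex_bij_betw_nat_finite[OF fine_familyD(2)[OF fine(1)]] by (auto simp: lessThan_atLeast0)
  show ?thesis
    unfolding sum.reindex_bij_betw[OF e, symmetric]
    using f fine_family_reindex[OF e fine(1)] fine_family_reindex[OF e fine(2)]
    by (auto simp: controls_def)
qed

lemma controls_outside:
  assumes f: "controls f \<epsilon> \<gamma> K" and fine: "fine_family \<gamma> J R c" and K: "\<And>i. i \<in> J \<Longrightarrow> R i \<inter> K = {}"
  shows "(\<Sum>i\<in>J. leb (R i) * norm (f (c i))) \<le> \<epsilon>"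
proof -
  obtain e where e: "bij_betw e {..<card J} J"
    using ex_bij_betw_nat_finite[OF fine_familyD(2)[OF fine]] by (auto simp: lessThan_atLeast0)
  have "\<forall>i\<in>{..<card J}. R (e i) \<inter> K = {}"
    using K bij_betw_apply[OF e] by blast
  then show ?thesis
    unfolding sum.reindex_bij_betw[OF e, symmetric]
    using f fine_family_reindex[OF e fine] by (auto simp: controls_def)
qed

lemma controls_mono:
  assumes "controls f \<epsilon> \<gamma> K" "gauge \<gamma>'" "\<And>x. \<gamma>' x \<subseteq> \<gamma> x"
  shows "controls f \<epsilon> \<gamma>' K"
  using assms(1,2) fine_family_mono[of \<gamma>' _ _ _ \<gamma>, OF _ assms(3)]
  unfolding controls_def by meson

text \<open>The disjoint sum of the index sets allows two families with different index types to be
  joined, as needed for a family and its completion.\<close>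

lemma fine_family_Plus:
  assumes "fine_family \<gamma> J R c" "fine_family \<gamma> J' R' c'"
    and "(\<Union>i\<in>J. R i) \<inter> (\<Union>j\<in>J'. R' j) = {}"
  shows "fine_family \<gamma> (J <+> J') (case_sum R R') (case_sum c c')"
proof -
  have "disjoint_family_on (case_sum R R') (J <+> J')"
    unfolding disjoint_family_on_def
  proof (intro ballI impI)
    fix x y assume xy: "x \<in> J <+> J'" "y \<in> J <+> J'" "x \<noteq> y"
    have disj: "disjoint_family_on R J" "disjoint_family_on R' J'"
      using assms(1,2) by (auto simp: fine_family_def rectangle_family_def)
    have disj3: "R i \<inter> R' j = {}" if "i \<in> J" "j \<in> J'" for i j
      using assms(3) that by blast
    then have disj4: "R' j \<inter> R i = {}" if "i \<in> J" "j \<in> J'" for i j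
      using that by (simp add: Int_commute)
    show "case_sum R R' x \<inter> case_sum R R' y = {}"
      using xy disj3 disj4 disjoint_family_onD[OF disj(1)] disjoint_family_onD[OF disj(2)]
      by (cases x; cases y) (simp_all add: Plus_def image_iff)
  qed
  then show ?thesis
    using assms(1,2) by (simp add: fine_family_def rectangle_family_def Plus_def ball_Un)
qed

lemma Union_Plus_case_sum:
  "(\<Union>i\<in>J <+> J'. case_sum R R' i) = (\<Union>i\<in>J. R i) \<union> (\<Union>j\<in>J'. R' j)"
  by (simp add: Plus_def image_Un image_image)

lemma riemann_sum_Plus:
  assumes "finite J" "finite J'"
  shows "riemann_sum f (J <+> J') (case_sum R R') (case_sum c c') = riemann_sum f J R c + riemann_sum f J' R' c'"
  using assms by (simp add: riemann_sum_def sum.Plus)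

text \<open>Completing a family to a cover in one fixed way makes the added terms cancel in
  differences of sums. The resulting bounds hold for every subfamily too, and in finite dimension
  this bounds the sum of the norms.\<close>

lemma gauge_integrable_imp_absolutely_cauchy:
  fixes f :: "real^'d \<Rightarrow> 'b::euclidean_space"
  assumes "gauge_integrable f"
  shows "absolutely_cauchy f"
  unfolding absolutely_cauchy_def
proof (intro allI impI)
  fix \<epsilon> :: real assume \<epsilon>: "\<epsilon> > 0"
  \<comment> \<open>Two sums within \<delta> of \<open>I\<close> differ by at most
    \<open>2 * \<delta>\<close>, and passing from all subfamilies to the sum of norms costs a factor
    \<open>2 * DIM('b)\<close>.\<close>
  define \<delta> where "\<delta> = \<epsilon> / (4 * DIM('b))"
  have \<delta>: "\<delta> > 0" "2 * real DIM('b) * (2 * \<delta>) = \<epsilon>"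
    using \<epsilon> by (auto simp: \<delta>_def field_simps)
  obtain I \<gamma> K where sums: "sums_close f I \<delta> \<gamma> K"
    using assms \<delta>(1) unfolding gauge_integrable_iff by blast
  then have \<gamma>: "gauge \<gamma>" and K: "compact K"
    by (auto simp: sums_close_def)
  note sums' = sums_close_family[OF sums]
  have tri: "norm (u - v) \<le> 2 * \<delta>" if "norm (u - I) \<le> \<delta>" "norm (v - I) \<le> \<delta>" for u v
    using norm_triangle_le_diff[of "u - I" "v - I" "2 * \<delta>"] that by simp
  have pairs: "norm (\<Sum>i\<in>J. leb (R i) *\<^sub>R (f (c i) - f (c' i))) \<le> 2 * \<delta>"
    if fine: "fine_family \<gamma> J R c" "fine_family \<gamma> J R c'" for J :: "nat set" and R c c'
  proof -
    obtain Q t where Q: "fine_family \<gamma> Q (\<lambda>S. S) t"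
        "(\<Union>i\<in>J. R i) \<inter> \<Union>Q = {}" "K \<subseteq> (\<Union>i\<in>J. R i) \<union> \<Union>Q"
      using fine_completion[OF fine_familyD(1)[OF fine(1)] \<gamma> compact_imp_bounded[OF K]] .
    have disj: "(\<Union>i\<in>J. R i) \<inter> (\<Union>S\<in>Q. S) = {}"
      using Q(2) by simp
    have cover: "K \<subseteq> (\<Union>i\<in>J <+> Q. case_sum R (\<lambda>S. S) i)"
      using Q(3) by (simp add: Union_Plus_case_sum)
    \<comment> \<open>The same \<open>Q\<close> and \<open>t\<close> complete the family under
      either tagging, so their sum drops out of the difference.\<close>
    have "norm (riemann_sum f J R c + riemann_sum f Q (\<lambda>S. S) t - I) \<le> \<delta>"
      if "fine_family \<gamma> J R c" for c
      using sums'[OF fine_family_Plus[OF that Q(1) disj] cover]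
      by (simp add: riemann_sum_Plus fine_familyD(2)[OF that] fine_familyD(2)[OF Q(1)])
    from tri[OF this[OF fine(1)] this[OF fine(2)]] show ?thesis
      by (simp add: riemann_sum_def sum_subtractf scaleR_diff_right)
  qed
  have outside: "norm (\<Sum>i\<in>J. leb (R i) *\<^sub>R f (c i)) \<le> 2 * \<delta>"
    if fine: "fine_family \<gamma> J R c" and JK: "\<forall>i\<in>J. R i \<inter> K = {}" for J :: "nat set" and R c
  proof -
    obtain Q t where Q: "fine_family \<gamma> Q (\<lambda>S. S) t"
        "(\<Union>i\<in>J. R i) \<inter> \<Union>Q = {}" "K \<subseteq> (\<Union>i\<in>J. R i) \<union> \<Union>Q"
      using fine_completion[OF fine_familyD(1)[OF fine] \<gamma> compact_imp_bounded[OF K]] .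
    have disj: "(\<Union>i\<in>J. R i) \<inter> (\<Union>S\<in>Q. S) = {}"
      using Q(2) by simp
    have cover: "K \<subseteq> (\<Union>i\<in>J <+> Q. case_sum R (\<lambda>S. S) i)"
      using Q(3) by (simp add: Union_Plus_case_sum)
    \<comment> \<open>Since the family avoids \<open>K\<close>, the completion alone already covers
      \<open>K\<close>; the sums with and without the family are both close to
      \<open>I\<close>.\<close>
    have cover': "K \<subseteq> (\<Union>S\<in>Q. S)"
      using Q(3) JK by blast
    have "norm (riemann_sum f J R c + riemann_sum f Q (\<lambda>S. S) t - I) \<le> \<delta>"
      using sums'[OF fine_family_Plus[OF fine Q(1) disj] cover]
      by (simp add: riemann_sum_Plus fine_familyD(2)[OF fine] fine_familyD(2)[OF Q(1)])
    from tri[OF this sums'[OF Q(1) cover']] show ?thesis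
      by (simp only: riemann_sum_def add_diff_cancel_right')
  qed
  have "controls f \<epsilon> \<gamma> K"
    unfolding controls_def
  proof (intro conjI allI impI)
    fix J :: "nat set" and R c c'
    assume fine: "fine_family \<gamma> J R c" "fine_family \<gamma> J R c'"
    have "(\<Sum>i\<in>J. norm (leb (R i) *\<^sub>R (f (c i) - f (c' i)))) \<le> 2 * real DIM('b) * (2 * \<delta>)"
      using fine_family_subset[OF fine(1)] fine_family_subset[OF fine(2)]
      by (intro sum_norm_allsubsets_bound fine_familyD(2)[OF fine(1)] pairs)
    then show "(\<Sum>i\<in>J. leb (R i) * norm (f (c i) - f (c' i))) \<le> \<epsilon>"
      unfolding \<delta>(2) by simp
  next
    fix J :: "nat set" and R c
    assume fine: "fine_family \<gamma> J R c" and JK: "\<forall>i\<in>J. R i \<inter> K = {}"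
    have "(\<Sum>i\<in>J. norm (leb (R i) *\<^sub>R f (c i))) \<le> 2 * real DIM('b) * (2 * \<delta>)"
      using fine_family_subset[OF fine] JK
      by (intro sum_norm_allsubsets_bound fine_familyD(2)[OF fine] outside) auto
    then show "(\<Sum>i\<in>J. leb (R i) * norm (f (c i))) \<le> \<epsilon>"
      unfolding \<delta>(2) by simp
  qed (fact \<gamma> K)+
  then show "\<exists>\<gamma> K. controls f \<epsilon> \<gamma> K"
    by blast
qed

section \<open>Common refinements\<close>

text \<open>For a gauge localised in this way, a rectangle that meets \<open>K\<close> lies entirely in \<open>B\<close>, so no
  rectangle has to be cut along the boundary of \<open>K\<close>.\<close>

lemma controls_localise:
  fixes K :: "(real^'d) set"
  assumes f: "controls f \<epsilon> \<gamma> K"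
  obtains \<gamma>' B where "controls f \<epsilon> \<gamma>' K" "compact B"
    "\<And>x S. S \<subseteq> \<gamma>' x \<Longrightarrow> S \<inter> K \<noteq> {} \<Longrightarrow> S \<subseteq> B"
proof -
  have K: "compact K" and \<gamma>: "gauge \<gamma>"
    using f by (auto simp: controls_def)
  obtain r where r: "K \<subseteq> ball 0 r"
    using bounded_subset_ballD[OF compact_imp_bounded[OF K], of 0] by auto
  \<comment> \<open>A set that meets \<open>K\<close> can only be fine for a tag in
    \<open>K\<close>, and is then confined to the ball. The complement of \<open>K\<close> is open
    because \<open>K\<close> is compact.\<close>
  define \<gamma>' where "\<gamma>' x = \<gamma> x \<inter> (if x \<in> K then ball 0 r else - K)" for x
  have "gauge \<gamma>'"
    using \<gamma> r compact_imp_closed[OF K] by (auto simp: gauge_def \<gamma>'_def)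
  then have "controls f \<epsilon> \<gamma>' K"
    by (rule controls_mono[OF f]) (auto simp: \<gamma>'_def)
  moreover have "S \<subseteq> cball 0 r" if "S \<subseteq> \<gamma>' x" "S \<inter> K \<noteq> {}" for x S
  proof (cases "x \<in> K")
    case True
    then show ?thesis
      using that(1) ball_subset_cball[of 0 r] by (auto simp: \<gamma>'_def)
  next
    case False
    then show ?thesis
      using that by (auto simp: \<gamma>'_def)
  qed
  ultimately show thesis
    using that[of \<gamma>' "cball 0 r"] by auto
qed

text \<open>The intersections \<open>R i \<inter> R' j\<close> form one family that is fine for both
  taggings, so the first clause of \<open>controls\<close> applies to it.\<close>

lemma controls_cross_sum:
  assumes f: "controls f \<epsilon> \<gamma> K" and fine: "fine_family \<gamma> J R c" "fine_family \<gamma> J' R' c'"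
  shows "(\<Sum>i\<in>J. \<Sum>j\<in>J'. leb (R i \<inter> R' j) * norm (f (c i) - f (c' j))) \<le> \<epsilon>"
proof -
  \<comment> \<open>Rectangles are nonempty, so empty intersections are left out; they contribute
    zero to the sum.\<close>
  define P where "P = {(i, j) \<in> J \<times> J'. R i \<inter> R' j \<noteq> {}}"
  have finP: "finite (J \<times> J')"
    using fine_familyD(2)[OF fine(1)] fine_familyD(2)[OF fine(2)] by simp
  have "is_rectangle (R i \<inter> R' j)" if "(i, j) \<in> P" for i j
    using that fine_familyD(3)[OF fine(1)] fine_familyD(3)[OF fine(2)]
    by (auto simp: P_def intro!: is_rectangle_Int)
  moreover have "disjoint_family_on (\<lambda>(i, j). R i \<inter> R' j) P"
    using fine_familyD(1)[OF fine(1)] fine_familyD(1)[OF fine(2)]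
    unfolding P_def rectangle_family_def disjoint_family_on_def by fast
  moreover have "finite P"
    using finP by (rule finite_subset[rotated]) (auto simp: P_def)
  ultimately have "rectangle_family P (\<lambda>(i, j). R i \<inter> R' j)"
    by (auto simp: rectangle_family_def)
  then have "fine_family \<gamma> P (\<lambda>(i, j). R i \<inter> R' j) (\<lambda>(i, j). c i)"
      "fine_family \<gamma> P (\<lambda>(i, j). R i \<inter> R' j) (\<lambda>(i, j). c' j)"
    using fine_familyD(4)[OF fine(1)] fine_familyD(4)[OF fine(2)]
    by (auto simp: fine_family_def P_def)
  note controls_pairs[OF f this]
  moreover have "(\<Sum>p\<in>P. leb (case p of (i, j) \<Rightarrow> R i \<inter> R' j) *
      norm (f (case p of (i, j) \<Rightarrow> c i) - f (case p of (i, j) \<Rightarrow> c' j)))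
    = (\<Sum>(i, j)\<in>J \<times> J'. leb (R i \<inter> R' j) * norm (f (c i) - f (c' j)))"
    using finP by (intro sum.mono_neutral_cong_left) (auto simp: P_def)
  ultimately show ?thesis
    by (simp add: sum.cartesian_product)
qed

text \<open>Rectangles meeting \<open>K\<close> leave nothing outside \<open>U\<close>; the others
  avoid \<open>K\<close> and fall under the second clause of \<open>controls\<close>. Note that
  \<open>R i - U\<close> need not be a rectangle, so it is first enlarged to
  \<open>R i\<close>.\<close>

lemma controls_remainder:
  assumes f: "controls f \<epsilon> \<gamma> K" and fine: "fine_family \<gamma> J R c"
    and U: "U \<in> sets borel" "\<And>i. i \<in> J \<Longrightarrow> R i \<inter> K \<noteq> {} \<Longrightarrow> R i \<subseteq> U"
  shows "(\<Sum>i\<in>J. leb (R i - U) * norm (f (c i))) \<le> \<epsilon>"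
proof -
  let ?J = "{i \<in> J. R i \<inter> K = {}}"
  have "leb (R i - U) = 0" if "i \<in> J - ?J" for i
  proof -
    have "R i - U = {}"
      using U(2) that by blast
    then show ?thesis
      by (simp only: measure_empty)
  qed
  then have "(\<Sum>i\<in>J. leb (R i - U) * norm (f (c i))) = (\<Sum>i\<in>?J. leb (R i - U) * norm (f (c i)))"
    using fine_familyD(2)[OF fine] by (intro sum.mono_neutral_right) auto
  also have "\<dots> \<le> (\<Sum>i\<in>?J. leb (R i) * norm (f (c i)))"
    using is_rectangle_lmeasurable[OF fine_familyD(3)[OF fine]] U(1)
    by (intro sum_mono mult_right_mono measure_mono_fmeasurable) (use is_rectangle_borel[OF fine_familyD(3)[OF fine]] in auto)
  also have "\<dots> \<le> \<epsilon>"
    by (rule controls_outside[OF f fine_family_subset[OF fine]]) auto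
  finally show ?thesis .
qed

lemma rectangle_family_Union_borel:
  assumes "rectangle_family J R"
  shows "(\<Union>i\<in>J. R i) \<in> sets borel"
  using assms is_rectangle_borel by (auto simp: rectangle_family_def intro!: sets.finite_UN)

text \<open>Both sums are refined to the common pieces \<open>R i \<inter> R' j\<close> plus a
  remainder. The refined parts \<open>X\<close> and \<open>X'\<close> have equal weights and differ
  only in their tags; together with the two remainders this gives three errors of size
  \<epsilon>.\<close>

lemma controls_riemann_sum_diff:
  assumes f: "controls f \<epsilon> \<gamma> K" and fine: "fine_family \<gamma> J R c" "fine_family \<gamma> J' R' c'"
    and cover: "\<And>i. i \<in> J \<Longrightarrow> R i \<inter> K \<noteq> {} \<Longrightarrow> R i \<subseteq> (\<Union>j\<in>J'. R' j)"
      "\<And>j. j \<in> J' \<Longrightarrow> R' j \<inter> K \<noteq> {} \<Longrightarrow> R' j \<subseteq> (\<Union>i\<in>J. R i)"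
  shows "norm (riemann_sum f J R c - riemann_sum f J' R' c') \<le> 3 * \<epsilon>"
proof -
  let ?U = "\<Union>i\<in>J. R i" and ?U' = "\<Union>j\<in>J'. R' j"
  note fam = fine_familyD(1)[OF fine(1)] fine_familyD(1)[OF fine(2)]
  define X where "X = (\<Sum>i\<in>J. \<Sum>j\<in>J'. leb (R i \<inter> R' j) *\<^sub>R f (c i))"
  define X' where "X' = (\<Sum>i\<in>J. \<Sum>j\<in>J'. leb (R i \<inter> R' j) *\<^sub>R f (c' j))"
  define Y where "Y = (\<Sum>i\<in>J. leb (R i - ?U') *\<^sub>R f (c i))"
  define Y' where "Y' = (\<Sum>j\<in>J'. leb (R' j - ?U) *\<^sub>R f (c' j))"
  have "riemann_sum f J R c = X + Y"
    unfolding riemann_sum_def X_def Y_def sum.distrib[symmetric] scaleR_sum_left[symmetric]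
    using rectangle_family_leb_split[OF fam(2) fine_familyD(3)[OF fine(1)]]
    by (intro sum.cong refl) (simp add: scaleR_add_left[symmetric])
  moreover have "riemann_sum f J' R' c' = X' + Y'"
    unfolding riemann_sum_def X'_def Y'_def sum.distrib[symmetric] sum.swap[of _ J' J] scaleR_sum_left[symmetric]
    using rectangle_family_leb_split[OF fam(1) fine_familyD(3)[OF fine(2)]]
    by (intro sum.cong refl) (simp add: scaleR_add_left[symmetric] Int_commute)
  moreover have "norm (X - X') \<le> \<epsilon>"
  proof -
    have "norm (X - X') \<le> (\<Sum>i\<in>J. \<Sum>j\<in>J'. leb (R i \<inter> R' j) * norm (f (c i) - f (c' j)))"
      unfolding X_def X'_def sum_subtractf[symmetric] scaleR_diff_right[symmetric]
      by (intro sum_norm_le order_refl) (simp add: sum_norm_le)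
    then show ?thesis
      using controls_cross_sum[OF f fine] by linarith
  qed
  moreover have "norm Y \<le> \<epsilon>"
    unfolding Y_def using controls_remainder[OF f fine(1) rectangle_family_Union_borel[OF fam(2)] cover(1)]
    by (intro order_trans[OF norm_sum]) simp
  moreover have "norm Y' \<le> \<epsilon>"
    unfolding Y'_def using controls_remainder[OF f fine(2) rectangle_family_Union_borel[OF fam(1)] cover(2)]
    by (intro order_trans[OF norm_sum]) simp
  moreover have "norm ((X + Y) - (X' + Y')) \<le> norm (X - X') + norm Y + norm Y'"
    using norm_triangle_ineq4[of "(X - X') + Y" Y'] norm_triangle_ineq[of "X - X'" Y]
    by (simp add: algebra_simps)
  ultimately show ?thesis
    by simp
qed

section \<open>Existence of the integral from the Cauchy condition\<close>

lemma fine_cover_exists: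
  fixes K :: "(real^'d) set"
  assumes "gauge \<gamma>" "bounded K"
  obtains Q t where "fine_family \<gamma> Q (\<lambda>S. S) t" "K \<subseteq> (\<Union>S\<in>Q. S)"
proof -
  \<comment> \<open>Completing the empty family yields a fine cover.\<close>
  have "rectangle_family ({} :: nat set) R" for R :: "nat \<Rightarrow> (real^'d) set"
    by (simp add: rectangle_family_def disjoint_family_on_def)
  from fine_completion[OF this assms] show thesis
    using that by auto
qed

text \<open>By localisation, a rectangle of either family that meets \<open>K\<close> lies in
  \<open>B\<close>, which the other family covers.\<close>

lemma controls_riemann_sum_close:
  assumes f: "controls f \<epsilon> \<gamma> K" and loc: "\<And>x S. S \<subseteq> \<gamma> x \<Longrightarrow> S \<inter> K \<noteq> {} \<Longrightarrow> S \<subseteq> B"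
    and fine: "fine_family \<gamma> J R c" "fine_family \<gamma> J' R' c'"
    and B: "B \<subseteq> (\<Union>i\<in>J. R i)" "B \<subseteq> (\<Union>j\<in>J'. R' j)"
  shows "norm (riemann_sum f J R c - riemann_sum f J' R' c') \<le> 3 * \<epsilon>"
proof (rule controls_riemann_sum_diff[OF f fine])
  show "R i \<subseteq> (\<Union>j\<in>J'. R' j)" if "i \<in> J" "R i \<inter> K \<noteq> {}" for i
    using loc[OF fine_familyD(4)[OF fine(1) that(1)] that(2)] B(2) by blast
  show "R' j \<subseteq> (\<Union>i\<in>J. R i)" if "j \<in> J'" "R' j \<inter> K \<noteq> {}" for j
    using loc[OF fine_familyD(4)[OF fine(2) that(1)] that(2)] B(1) by blast
qed

lemma sums_closeI:
  assumes "gauge \<gamma>" "compact K"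
    and sums: "\<And>(J::nat set) R c. fine_family \<gamma> J R c \<Longrightarrow> K \<subseteq> (\<Union>i\<in>J. R i) \<Longrightarrow>
      norm (riemann_sum f J R c - I) \<le> \<epsilon>"
  shows "sums_close f I \<epsilon> \<gamma> K"
  unfolding sums_close_def
proof (intro conjI allI impI)
  fix k a b c
  assume dr: "disjoint_rectangles k a b" and K: "K \<subseteq> (\<Union>i<k. rectangle (a i) (b i))"
    and \<gamma>: "\<forall>i<k. rectangle (a i) (b i) \<subseteq> \<gamma> (c i)"
  have "fine_family \<gamma> {..<k} (\<lambda>i. rectangle (a i) (b i)) c"
    using disjoint_rectangles_family[OF dr] \<gamma> by (simp add: fine_family_def)
  moreover have "riemann_sum f {..<k} (\<lambda>i. rectangle (a i) (b i)) c = (\<Sum>i<k. vol (a i) (b i) *\<^sub>R f (c i))"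
    using dr unfolding riemann_sum_def by (intro sum.cong) (auto simp: disjoint_rectangles_def leb_rectangle)
  ultimately show "norm ((\<Sum>i<k. vol (a i) (b i) *\<^sub>R f (c i)) - I) \<le> \<epsilon>"
    using sums[of "{..<k}" "\<lambda>i. rectangle (a i) (b i)" c] K by simp
qed fact+

text \<open>The integral is the limit of sums over ever finer covers, which form a Cauchy sequence
  in a complete space.\<close>

lemma absolutely_cauchy_imp_gauge_integrable:
  fixes f :: "real^'d \<Rightarrow> 'b::banach"
  assumes "absolutely_cauchy f"
  shows "gauge_integrable f"
proof -
  define e where "e n = inverse (real (Suc n))" for n
  have e: "e n > 0" for n
    by (simp add: e_def)
  have "\<exists>\<gamma> K B. controls f (e n) \<gamma> K \<and> compact B \<and>
      (\<forall>x S. S \<subseteq> \<gamma> x \<longrightarrow> S \<inter> K \<noteq> {} \<longrightarrow> S \<subseteq> B)" for n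
  proof -
    obtain \<gamma> K where "controls f (e n) \<gamma> K"
      using assms e unfolding absolutely_cauchy_def by blast
    from controls_localise[OF this] show ?thesis
      by metis
  qed
  then obtain g K B where g: "\<And>n. controls f (e n) (g n) (K n)" and B: "\<And>n. compact (B n)"
      and loc: "\<And>n x S. S \<subseteq> g n x \<Longrightarrow> S \<inter> K n \<noteq> {} \<Longrightarrow> S \<subseteq> B n"
    by metis
  have gauge: "gauge (g n)" for n
    using g by (auto simp: controls_def)
  \<comment> \<open>Intersecting the first gauges and uniting the first compact sets makes the
    \<open>m\<close>-th cover admissible at every earlier level \<open>n \<le> m\<close>. Finite
    intersections keep the gauge open.\<close>
  define G where "G n x = (\<Inter>m\<le>n. g m x)" for n x
  define C where "C n = (\<Union>m\<le>n. B m)" for n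
  have "\<exists>Q t. fine_family (G n) Q (\<lambda>S. S) t \<and> C n \<subseteq> (\<Union>S\<in>Q. S)" for n
  proof -
    have "gauge (G n)"
      using gauge by (auto simp: gauge_def G_def)
    moreover have "bounded (C n)"
      using B by (auto simp: C_def compact_imp_bounded)
    ultimately show ?thesis
      using fine_cover_exists by metis
  qed
  then obtain Q t where Q: "\<And>n. fine_family (G n) (Q n) (\<lambda>S. S) (t n)" "\<And>n. C n \<subseteq> (\<Union>S\<in>Q n. S)"
    by metis
  define s where "s n = riemann_sum f (Q n) (\<lambda>S. S) (t n)" for n
  have fine: "fine_family (g n) (Q m) (\<lambda>S. S) (t m)" and cover: "B n \<subseteq> (\<Union>S\<in>Q m. S)"
    if "n \<le> m" for n m
  proof -
    show "fine_family (g n) (Q m) (\<lambda>S. S) (t m)"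
      using that by (intro fine_family_mono[OF Q(1)]) (auto simp: G_def)
    show "B n \<subseteq> (\<Union>S\<in>Q m. S)"
      using that Q(2)[of m] by (auto simp: C_def)
  qed
  have close: "norm (riemann_sum f J R c - s m) \<le> 3 * e n"
    if "fine_family (g n) J R c" "B n \<subseteq> (\<Union>i\<in>J. R i)" "n \<le> m" for J :: "'j set" and R c n m
    unfolding s_def
    by (rule controls_riemann_sum_close[OF g loc that(1) fine[OF that(3)] that(2) cover[OF that(3)]])
  have close': "norm (s k - s m) \<le> 3 * e n" if "n \<le> k" "n \<le> m" for k m n
    unfolding s_def
    by (rule controls_riemann_sum_close[OF g loc fine[OF that(1)] fine[OF that(2)]
          cover[OF that(1)] cover[OF that(2)]])
  have small: "\<exists>n. 3 * e n < \<epsilon>" if "\<epsilon> > 0" for \<epsilon>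
    using reals_Archimedean[of "\<epsilon> / 3"] that by (auto simp: e_def mult.commute)
  have "Cauchy s"
    unfolding Cauchy_iff using small close' by (meson le_less_trans)
  then obtain I where I: "s \<longlonglongrightarrow> I"
    using Cauchy_convergent convergent_def by blast
  show ?thesis
    unfolding gauge_integrable_iff
  proof (intro exI[of _ I] allI impI)
    fix \<epsilon> :: real assume "\<epsilon> > 0"
    then obtain n where n: "3 * e n < \<epsilon>"
      using small by blast
    have "sums_close f I \<epsilon> (g n) (B n)"
    proof (rule sums_closeI[OF gauge B])
      fix J :: "nat set" and R c
      assume J: "fine_family (g n) J R c" "B n \<subseteq> (\<Union>i\<in>J. R i)"
      \<comment> \<open>The bound \<open>3 * e n\<close> holds for all \<open>m \<ge> n\<close> and
        survives the limit in \<open>m\<close>.\<close>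
      have "(\<lambda>m. norm (riemann_sum f J R c - s m)) \<longlonglongrightarrow> norm (riemann_sum f J R c - I)"
        using I by (intro tendsto_intros)
      then have "norm (riemann_sum f J R c - I) \<le> 3 * e n"
        by (rule LIMSEQ_le_const2)
           (auto intro!: exI[of _ n] controls_riemann_sum_close[OF g loc J(1) fine J(2) cover] simp: s_def)
      then show "norm (riemann_sum f J R c - I) \<le> \<epsilon>"
        using n by simp
    qed
    then show "\<exists>\<gamma> K. sums_close f I \<epsilon> \<gamma> K"
      by blast
  qed
qed

section \<open>Measurability and domination\<close>

lemma gauge_measurable_iff:
  "gauge_measurable f \<longleftrightarrow> (\<forall>\<epsilon>>0. \<forall>\<eta>>0. \<exists>\<gamma>. gauge \<gamma> \<and>
     (\<forall>(J::nat set) R c c'. fine_family \<gamma> J R c \<longrightarrow> fine_family \<gamma> J R c' \<longrightarrow>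
        (\<forall>i\<in>J. \<eta> \<le> norm (f (c i) - f (c' i))) \<longrightarrow> (\<Sum>i\<in>J. leb (R i)) \<le> \<epsilon>))"
proof -
  have "(\<forall>k a b c c'. disjoint_rectangles k a b \<longrightarrow>
        (\<forall>i<k. norm (f (c i) - f (c' i)) \<ge> \<eta> \<and> rectangle (a i) (b i) \<subseteq> \<gamma> (c i) \<inter> \<gamma> (c' i)) \<longrightarrow>
        (\<Sum>i<k. vol (a i) (b i)) \<le> \<epsilon>) \<longleftrightarrow>
      (\<forall>(J::nat set) R c c'. fine_family \<gamma> J R c \<longrightarrow> fine_family \<gamma> J R c' \<longrightarrow>
        (\<forall>i\<in>J. \<eta> \<le> norm (f (c i) - f (c' i))) \<longrightarrow> (\<Sum>i\<in>J. leb (R i)) \<le> \<epsilon>)"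
    (is "?L \<longleftrightarrow> ?R") for \<epsilon> \<eta> :: real and \<gamma>
  proof
    assume L: ?L
    show ?R
    proof (intro allI impI)
      fix J :: "nat set" and R c c'
      assume fine: "fine_family \<gamma> J R c" "fine_family \<gamma> J R c'"
        and \<eta>: "\<forall>i\<in>J. \<eta> \<le> norm (f (c i) - f (c' i))"
      obtain k e a b where e: "bij_betw e {..<k} J" and ab: "disjoint_rectangles k a b"
          "\<And>i. i < k \<Longrightarrow> R (e i) = rectangle (a i) (b i)"
          "\<And>i. i < k \<Longrightarrow> vol (a i) (b i) = leb (R (e i))"
        using rectangle_family_enumerate[OF fine_familyD(1)[OF fine(1)]] by metis
      have eJ: "e i \<in> J" if "i < k" for i
        using bij_betw_apply[OF e] that by simp
      have "(\<Sum>i<k. vol (a i) (b i)) \<le> \<epsilon>"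
      proof (rule L[rule_format, OF ab(1)])
        fix i assume i: "i < k"
        show "\<eta> \<le> norm (f (c (e i)) - f (c' (e i))) \<and>
            rectangle (a i) (b i) \<subseteq> \<gamma> (c (e i)) \<inter> \<gamma> (c' (e i))"
          unfolding ab(2)[OF i, symmetric]
          using \<eta> fine_familyD(4)[OF fine(1) eJ[OF i]] fine_familyD(4)[OF fine(2) eJ[OF i]] eJ[OF i]
          by blast
      qed
      then show "(\<Sum>i\<in>J. leb (R i)) \<le> \<epsilon>"
        unfolding sum.reindex_bij_betw[OF e, symmetric] using ab(3) by simp
    qed
  next
    assume R: ?R
    show ?L
    proof (intro allI impI)
      fix k a b c c'
      assume dr: "disjoint_rectangles k a b" and \<gamma>: "\<forall>i<k. norm (f (c i) - f (c' i)) \<ge> \<eta> \<and>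
          rectangle (a i) (b i) \<subseteq> \<gamma> (c i) \<inter> \<gamma> (c' i)"
      have "(\<Sum>i<k. leb (rectangle (a i) (b i))) \<le> \<epsilon>"
        using disjoint_rectangles_family[OF dr] \<gamma>
        by (intro R[rule_format, of "{..<k}" _ c c']) (auto simp: fine_family_def)
      then show "(\<Sum>i<k. vol (a i) (b i)) \<le> \<epsilon>"
        using dr by (simp add: disjoint_rectangles_def leb_rectangle)
    qed
  qed
  then show ?thesis
    unfolding gauge_measurable_def by simp
qed

lemma absolutely_cauchy_imp_gauge_measurable:
  assumes "absolutely_cauchy f"
  shows "gauge_measurable f"
  unfolding gauge_measurable_iff
proof (intro allI impI)
  fix \<epsilon> \<eta> :: real assume "\<epsilon> > 0" and \<eta>: "\<eta> > 0"
  \<comment> \<open>Chebyshev's inequality below divides the bound by \<eta>.\<close>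
  then obtain \<gamma> K where f: "controls f (\<epsilon> * \<eta>) \<gamma> K"
    using assms unfolding absolutely_cauchy_def by (metis mult_pos_pos)
  have "(\<Sum>i\<in>J. leb (R i)) \<le> \<epsilon>"
    if "fine_family \<gamma> J R c" "fine_family \<gamma> J R c'" "\<forall>i\<in>J. \<eta> \<le> norm (f (c i) - f (c' i))"
    for J :: "nat set" and R c c'
  proof -
    have "(\<Sum>i\<in>J. leb (R i)) * \<eta> \<le> (\<Sum>i\<in>J. leb (R i) * norm (f (c i) - f (c' i)))"
      unfolding sum_distrib_right using that(3) by (intro sum_mono mult_left_mono) auto
    also have "\<dots> \<le> \<epsilon> * \<eta>"
      by (rule controls_pairs[OF f that(1,2)])
    finally show ?thesis
      using \<eta> by simp
  qed
  then show "\<exists>\<gamma>. gauge \<gamma> \<and> (\<forall>(J::nat set) R c c'. fine_family \<gamma> J R c \<longrightarrow> fine_family \<gamma> J R c' \<longrightarrow>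
      (\<forall>i\<in>J. \<eta> \<le> norm (f (c i) - f (c' i))) \<longrightarrow> (\<Sum>i\<in>J. leb (R i)) \<le> \<epsilon>)"
    using f unfolding controls_def by blast
qed

text \<open>The reverse triangle inequality, with the same gauge and compact set.\<close>

lemma absolutely_cauchy_norm:
  assumes "absolutely_cauchy f"
  shows "absolutely_cauchy (\<lambda>x. norm (f x))"
proof -
  have "controls (\<lambda>x. norm (f x)) \<epsilon> \<gamma> K" if f: "controls f \<epsilon> \<gamma> K" for \<epsilon> \<gamma> K
  proof -
    have "(\<Sum>i\<in>J. leb (R i) * norm (norm (f (c i)) - norm (f (c' i)))) \<le> \<epsilon>"
      if "fine_family \<gamma> J R c" "fine_family \<gamma> J R c'" for J :: "nat set" and R c c'
      by (rule order_trans[OF _ controls_pairs[OF f that]])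
         (auto intro!: sum_mono mult_left_mono norm_triangle_ineq3)
    then show ?thesis
      using f by (simp add: controls_def)
  qed
  then show ?thesis
    using assms unfolding absolutely_cauchy_def by meson
qed

section \<open>Absolute continuity and dominated functions\<close>

text \<open>Absolute continuity of the indefinite integral: comparing with one fixed fine cover of a compact
  set replaces \<open>h\<close> by a bounded function, up to a controlled error.\<close>

lemma absolutely_cauchy_small:
  assumes "absolutely_cauchy h" and \<epsilon>: "\<epsilon> > 0"
  obtains \<gamma> \<delta> where "gauge \<gamma>" "\<delta> > 0"
    "\<forall>(J::nat set) R c. fine_family \<gamma> J R c \<longrightarrow> (\<Sum>i\<in>J. leb (R i)) \<le> \<delta> \<longrightarrow>
      (\<Sum>i\<in>J. leb (R i) * norm (h (c i))) \<le> \<epsilon>"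
proof -
  obtain \<gamma>0 K where "controls h (\<epsilon> / 3) \<gamma>0 K"
    using assms unfolding absolutely_cauchy_def by (metis zero_less_divide_iff zero_less_numeral)
  then obtain \<gamma> B where h: "controls h (\<epsilon> / 3) \<gamma> K" and B: "compact B"
      and loc: "\<And>x S. S \<subseteq> \<gamma> x \<Longrightarrow> S \<inter> K \<noteq> {} \<Longrightarrow> S \<subseteq> B"
    by (rule controls_localise) blast
  have \<gamma>: "gauge \<gamma>"
    using h by (simp add: controls_def)
  obtain Q t where Q: "fine_family \<gamma> Q (\<lambda>S. S) t" "B \<subseteq> (\<Union>S\<in>Q. S)"
    using fine_cover_exists[OF \<gamma> compact_imp_bounded[OF B]] .
  note finQ = fine_familyD(2)[OF Q(1)]
  \<comment> \<open>A bound for \<open>h\<close> at the finitely many tags of the fixed cover;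
    adding 1 makes it positive, so that \<open>\<epsilon> / 3 / M\<close> is a legitimate
    threshold.\<close>
  define M where "M = (\<Sum>S\<in>Q. norm (h (t S))) + 1"
  have M: "M > 0"
    by (simp add: M_def sum_nonneg add_nonneg_pos)
  have hM: "norm (h (t S)) \<le> M" if "S \<in> Q" for S
    using member_le_sum[OF that, of "\<lambda>S. norm (h (t S))"] finQ by (simp add: M_def)
  show thesis
  proof (rule that[OF \<gamma>, of "\<epsilon> / 3 / M"])
    show "\<epsilon> / 3 / M > 0"
      using M \<epsilon> by simp
    show "\<forall>(J::nat set) R c. fine_family \<gamma> J R c \<longrightarrow> (\<Sum>i\<in>J. leb (R i)) \<le> \<epsilon> / 3 / M \<longrightarrow>
        (\<Sum>i\<in>J. leb (R i) * norm (h (c i))) \<le> \<epsilon>"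
    proof (intro allI impI)
      fix J :: "nat set" and R c
      assume fine: "fine_family \<gamma> J R c" and \<delta>: "(\<Sum>i\<in>J. leb (R i)) \<le> \<epsilon> / 3 / M"
      let ?U = "\<Union>S\<in>Q. S"
      \<comment> \<open>The three terms are the cost of replacing \<open>c i\<close> by the tags
        \<open>t S\<close>, the bounded part, and what lies outside the cover. Summed over
        \<open>J\<close>, each is at most \<open>\<epsilon> / 3\<close>.\<close>
      have "leb (R i) * norm (h (c i)) \<le> (\<Sum>S\<in>Q. leb (R i \<inter> S) * norm (h (c i) - h (t S)))
          + M * leb (R i) + leb (R i - ?U) * norm (h (c i))" if i: "i \<in> J" for i
      proof -
        have split: "leb (R i) = (\<Sum>S\<in>Q. leb (R i \<inter> S)) + leb (R i - ?U)"
          by (rule rectangle_family_leb_split[OF fine_familyD(1)[OF Q(1)] fine_familyD(3)[OF fine i]])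
        have "norm (h (c i)) \<le> norm (h (c i) - h (t S)) + M" if "S \<in> Q" for S
          using norm_triangle_sub[of "h (c i)" "h (t S)"] hM[OF that] by linarith
        then have "(\<Sum>S\<in>Q. leb (R i \<inter> S) * norm (h (c i)))
            \<le> (\<Sum>S\<in>Q. leb (R i \<inter> S) * (norm (h (c i) - h (t S)) + M))"
          by (intro sum_mono mult_left_mono) auto
        also have "\<dots> = (\<Sum>S\<in>Q. leb (R i \<inter> S) * norm (h (c i) - h (t S))) + M * (\<Sum>S\<in>Q. leb (R i \<inter> S))"
          by (simp add: distrib_left sum.distrib sum_distrib_left mult.commute)
        also have "\<dots> \<le> (\<Sum>S\<in>Q. leb (R i \<inter> S) * norm (h (c i) - h (t S))) + M * leb (R i)"
          using M split by simp
        finally show ?thesis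
          by (subst split) (simp add: distrib_right sum_distrib_right)
      qed
      then have "(\<Sum>i\<in>J. leb (R i) * norm (h (c i)))
          \<le> (\<Sum>i\<in>J. \<Sum>S\<in>Q. leb (R i \<inter> S) * norm (h (c i) - h (t S)))
            + M * (\<Sum>i\<in>J. leb (R i)) + (\<Sum>i\<in>J. leb (R i - ?U) * norm (h (c i)))"
        unfolding sum_distrib_left sum.distrib[symmetric] by (rule sum_mono)
      moreover have "M * (\<Sum>i\<in>J. leb (R i)) \<le> \<epsilon> / 3"
        using \<delta> M by (simp add: pos_le_divide_eq mult.commute)
      moreover have "(\<Sum>i\<in>J. leb (R i - ?U) * norm (h (c i))) \<le> \<epsilon> / 3"
      proof (rule controls_remainder[OF h fine rectangle_family_Union_borel[OF fine_familyD(1)[OF Q(1)]]])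
        show "R i \<subseteq> ?U" if "i \<in> J" "R i \<inter> K \<noteq> {}" for i
          using loc[OF fine_familyD(4)[OF fine that(1)] that(2)] Q(2) by blast
      qed
      ultimately show "(\<Sum>i\<in>J. leb (R i) * norm (h (c i))) \<le> \<epsilon>"
        using controls_cross_sum[OF h fine Q(1)] by linarith
    qed
  qed
qed

lemma dominated_imp_absolutely_cauchy:
  fixes f :: "real^'d \<Rightarrow> 'b::real_normed_vector" and h :: "real^'d \<Rightarrow> real"
  assumes f: "gauge_measurable f" and h: "absolutely_cauchy h" and fh: "\<And>x. norm (f x) \<le> h x"
  shows "absolutely_cauchy f"
  unfolding absolutely_cauchy_def
proof (intro allI impI)
  fix \<epsilon> :: real assume \<epsilon>: "\<epsilon> > 0"
  have nh: "norm (h x) = h x" "0 \<le> h x" for x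
    using fh[of x] order_trans[OF norm_ge_zero fh] by auto
  obtain \<gamma>0 K where "controls h (\<epsilon> / 8) \<gamma>0 K"
    using h \<epsilon> unfolding absolutely_cauchy_def by (metis zero_less_divide_iff zero_less_numeral)
  then obtain \<gamma>1 B where \<gamma>1: "controls h (\<epsilon> / 8) \<gamma>1 K" and B: "compact B"
      and loc: "\<And>x S. S \<subseteq> \<gamma>1 x \<Longrightarrow> S \<inter> K \<noteq> {} \<Longrightarrow> S \<subseteq> B"
    by (rule controls_localise) blast
  obtain \<gamma>2 \<delta> where \<gamma>2: "gauge \<gamma>2" "\<delta> > 0"
      "\<forall>(J::nat set) R c. fine_family \<gamma>2 J R c \<longrightarrow> (\<Sum>i\<in>J. leb (R i)) \<le> \<delta> \<longrightarrow>
        (\<Sum>i\<in>J. leb (R i) * norm (h (c i))) \<le> \<epsilon> / 8"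
    using absolutely_cauchy_small[OF h, of "\<epsilon> / 8"] \<epsilon> by auto
  define V where "V = leb B + 1"
  \<comment> \<open>Disjoint rectangles inside \<open>B\<close> have total volume at most
    \<open>leb B\<close>, so an oscillation below \<eta> costs at most \<open>\<epsilon> / 4\<close>
    there. The summand 1 in \<open>V\<close> avoids division by zero.\<close>
  define \<eta> where "\<eta> = \<epsilon> / 4 / V"
  have V: "V > 0" "leb B \<le> V"
    by (simp_all add: V_def add_nonneg_pos)
  have \<eta>: "\<eta> > 0" "leb B * \<eta> \<le> \<epsilon> / 4"
  proof -
    show "\<eta> > 0"
      using \<epsilon> V(1) by (simp add: \<eta>_def)
    then have "leb B * \<eta> \<le> V * \<eta>"
      using V(2) by simp
    also have "\<dots> = \<epsilon> / 4"
      using V(1) by (simp add: \<eta>_def)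
    finally show "leb B * \<eta> \<le> \<epsilon> / 4" .
  qed
  \<comment> \<open>Measurability is invoked with the volume threshold \<delta> from absolute
    continuity in place of \<epsilon>.\<close>
  obtain \<gamma>3 where \<gamma>3: "gauge \<gamma>3"
      "\<forall>(J::nat set) R c c'. fine_family \<gamma>3 J R c \<longrightarrow> fine_family \<gamma>3 J R c' \<longrightarrow>
        (\<forall>i\<in>J. \<eta> \<le> norm (f (c i) - f (c' i))) \<longrightarrow> (\<Sum>i\<in>J. leb (R i)) \<le> \<delta>"
    using f[unfolded gauge_measurable_iff, THEN spec, THEN mp, OF \<gamma>2(2), THEN spec, THEN mp, OF \<eta>(1)]
    by (elim exE conjE) (rule that)
  define \<gamma> where "\<gamma> x = \<gamma>1 x \<inter> \<gamma>2 x \<inter> \<gamma>3 x" for x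
  have gauge: "gauge \<gamma>" and K: "compact K"
    using \<gamma>1 \<gamma>2(1) \<gamma>3(1) by (auto simp: controls_def \<gamma>_def[abs_def])
  have fine1: "fine_family \<gamma>1 J R c" and fine2: "fine_family \<gamma>2 J R c" and fine3: "fine_family \<gamma>3 J R c"
    if "fine_family \<gamma> J R c" for J :: "nat set" and R c
    using that by (auto intro: fine_family_mono simp: \<gamma>_def)
  have outside: "(\<Sum>i\<in>J. leb (R i) * h (c i)) \<le> \<epsilon> / 8"
    if "fine_family \<gamma> J R c" "\<And>i. i \<in> J \<Longrightarrow> R i \<inter> K = {}" for J :: "nat set" and R c
    using controls_outside[OF \<gamma>1 fine1[OF that(1)] that(2)] by (simp only: nh)
  have small: "(\<Sum>i\<in>J. leb (R i) * h (c i)) \<le> \<epsilon> / 8"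
    if "fine_family \<gamma> J R c" "(\<Sum>i\<in>J. leb (R i)) \<le> \<delta>" for J :: "nat set" and R c
    using \<gamma>2(3) fine2[OF that(1)] that(2) by (simp only: nh)
  have sum_diff_le: "(\<Sum>i\<in>J. leb (R i) * norm (f (c i) - f (c' i)))
      \<le> (\<Sum>i\<in>J. leb (R i) * h (c i)) + (\<Sum>i\<in>J. leb (R i) * h (c' i))" for J :: "nat set" and R c c'
    unfolding sum.distrib[symmetric] distrib_left[symmetric]
    by (intro sum_mono mult_left_mono order_trans[OF norm_triangle_ineq4] add_mono fh) auto
  have "controls f \<epsilon> \<gamma> K"
    unfolding controls_def
  proof (intro conjI allI impI)
    fix J :: "nat set" and R c c'
    assume fine: "fine_family \<gamma> J R c" "fine_family \<gamma> J R c'"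
    \<comment> \<open>\<open>J1\<close> lies outside \<open>K\<close>; the rest lies in
      \<open>B\<close> and is split by oscillation, small on \<open>J2\<close> and at least \<eta>
      on \<open>J3\<close>. Each part contributes at most \<open>\<epsilon> / 4\<close>.\<close>
    define J1 where "J1 = {i \<in> J. R i \<inter> K = {}}"
    define J2 where "J2 = {i \<in> J - J1. norm (f (c i) - f (c' i)) < \<eta>}"
    define J3 where "J3 = J - J1 - J2"
    have J: "J1 \<subseteq> J" "J2 \<subseteq> J" "J3 \<subseteq> J"
      by (auto simp: J1_def J2_def J3_def)
    note fine' = fine_family_subset[OF fine(1)] fine_family_subset[OF fine(2)]
    let ?s = "\<lambda>i. leb (R i) * norm (f (c i) - f (c' i))"
    have "sum ?s J1 \<le> \<epsilon> / 8 + \<epsilon> / 8"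
      using J(1) by (intro order_trans[OF sum_diff_le] add_mono outside fine') (auto simp: J1_def)
    moreover have "sum ?s J2 \<le> \<epsilon> / 4"
    proof -
      have "sum ?s J2 \<le> (\<Sum>i\<in>J2. leb (R i) * \<eta>)"
        by (intro sum_mono mult_left_mono) (auto simp: J2_def)
      also have "\<dots> = (\<Sum>i\<in>J2. leb (R i)) * \<eta>"
        by (simp add: sum_distrib_right)
      also have "\<dots> \<le> leb B * \<eta>"
      proof (intro mult_right_mono rectangle_family_sum_leb_le B)
        show "rectangle_family J2 R"
          using fine_familyD(1)[OF fine'(1)[OF J(2)]] .
        show "R i \<subseteq> B" if "i \<in> J2" for i
          using that fine_familyD(4)[OF fine1[OF fine(1)]]
          by (intro loc[of "R i" "c i"]) (auto simp: J2_def J1_def)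
      qed (use \<eta> in simp)
      finally show ?thesis
        using \<eta>(2) by simp
    qed
    moreover have "sum ?s J3 \<le> \<epsilon> / 8 + \<epsilon> / 8"
    proof -
      have "(\<Sum>i\<in>J3. leb (R i)) \<le> \<delta>"
        using fine3[OF fine'(1)[OF J(3)]] fine3[OF fine'(2)[OF J(3)]]
        by (intro \<gamma>3(2)[rule_format, of J3 R c c']) (auto simp: J3_def J2_def)
      then show ?thesis
        using J(3) by (intro order_trans[OF sum_diff_le] add_mono small fine')
    qed
    moreover have "sum ?s J = sum ?s J1 + sum ?s J2 + sum ?s J3"
    proof -
      have "sum ?s J = sum ?s (J1 \<union> J2 \<union> J3)"
        by (rule arg_cong[of _ _ "sum ?s"]) (auto simp: J1_def J2_def J3_def)
      also have "\<dots> = sum ?s (J1 \<union> J2) + sum ?s J3"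
        using fine_familyD(2)[OF fine(1)] J
        by (intro sum.union_disjoint) (auto simp: J1_def J2_def J3_def)
      also have "sum ?s (J1 \<union> J2) = sum ?s J1 + sum ?s J2"
        using fine_familyD(2)[OF fine(1)] J
        by (intro sum.union_disjoint) (auto simp: J1_def J2_def)
      finally show ?thesis .
    qed
    ultimately show "sum ?s J \<le> \<epsilon>"
      using \<epsilon> by linarith
  next
    fix J :: "nat set" and R c
    assume "fine_family \<gamma> J R c" "\<forall>i\<in>J. R i \<inter> K = {}"
    then have "(\<Sum>i\<in>J. leb (R i) * h (c i)) \<le> \<epsilon> / 8"
      by (intro outside) auto
    moreover have "(\<Sum>i\<in>J. leb (R i) * norm (f (c i))) \<le> (\<Sum>i\<in>J. leb (R i) * h (c i))"
      by (intro sum_mono mult_left_mono fh) auto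
    ultimately show "(\<Sum>i\<in>J. leb (R i) * norm (f (c i))) \<le> \<epsilon>"
      using \<epsilon> by simp
  qed fact+
  then show "\<exists>\<gamma> K. controls f \<epsilon> \<gamma> K"
    by blast
qed

theorem theorem1p3:
  fixes f :: "real^'d \<Rightarrow> real^'p"
  shows "gauge_integrable f \<longleftrightarrow>
    gauge_measurable f \<and>
    (\<exists>h :: real^'d \<Rightarrow> real. gauge_integrable h \<and> (\<forall>x. norm (f x) \<le> h x))"
proof
  assume "gauge_integrable f"
  then have f: "absolutely_cauchy f"
    by (rule gauge_integrable_imp_absolutely_cauchy)
  \<comment> \<open>The norm of \<open>f\<close> serves as its own integrable majorant.\<close>
  then have "gauge_integrable (\<lambda>x. norm (f x))"
    by (intro absolutely_cauchy_imp_gauge_integrable absolutely_cauchy_norm)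
  then show "gauge_measurable f \<and>
      (\<exists>h :: real^'d \<Rightarrow> real. gauge_integrable h \<and> (\<forall>x. norm (f x) \<le> h x))"
    using absolutely_cauchy_imp_gauge_measurable[OF f] by blast
next
  assume "gauge_measurable f \<and>
    (\<exists>h :: real^'d \<Rightarrow> real. gauge_integrable h \<and> (\<forall>x. norm (f x) \<le> h x))"
  then obtain h :: "real^'d \<Rightarrow> real"
    where "gauge_measurable f" "absolutely_cauchy h" "\<And>x. norm (f x) \<le> h x"
    using gauge_integrable_imp_absolutely_cauchy[where 'b = real] by auto
  then show "gauge_integrable f"
    by (rule absolutely_cauchy_imp_gauge_integrable[OF dominated_imp_absolutely_cauchy])
qed

end
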